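(* Let $(M,A,f)$ be a crossed module over an associative algebra and let $\psi:M\to A$, $\omega:A\otimes A\to A$, $\mu:A\otimes M\to M$, $\nu:M\otimes A\to M$ be linear maps. Then $(\psi,\omega,\mu,\nu)$ generates a 1-parameter infinitesimal deformation of $(M,A,f)$ if and only if both of the following hold: (i) $(\psi,\omega,\mu,\nu)$ is a 2-cocycle of $(M,A,f)$ with coefficients in the adjoint representation; (ii) $(M,A,\psi)$ is a crossed module over an associative algebra, with multiplication $\omega$ on $A$ and representation structure of $(A,\omega)$ on $M$ given by $\mu$ (left action) and $\nu$ (right action).
   Context: All vector spaces are over a fixed field; associative algebras are not assumed unital. A representation of an associative algebra $A$ is a vector space $M$ with bilinear maps $A\otimes M\to M$, $M\otimes A\to M$ (written $\cdot$) such that $(x\cdot y)\cdot m=x\cdot(y\cdot m)$, $x\cdot(m\cdot y)=(x\cdot m)\cdot y$, $m\cdot(x\cdot y)=(m\cdot x)\cdot y$. A crossed module over an associative algebra is a triple $(M,A,f)$ where $A$ is an associative algebra, $M$ is a representation of $A$, and $f:M\to A$ is a linear map such that for all $x\in A$, $a,b\in M$: $f(x\cdot a)=x\cdot f(a)$, $f(a\cdot x)=f(a)\cdot x$, and $f(a)\cdot b=a\cdot f(b)$. Deformation. Put $f_\lambda(a)=f(a)+\lambda\psi(a)$, $x\cdot_\lambda y=x\cdot y+\lambda\omega(x,y)$, $x\cdot_\lambda a=x\cdot a+\lambda\mu(x,a)$, $a\cdot_\lambda x=a\cdot x+\lambda\nu(a,x)$. One says that $(\psi,\omega,\mu,\nu)$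 generates a 1-parameter infinitesimal deformation of $(M,A,f)$ if $M,A$ with these operations and $f_\lambda$ form a crossed module over an associative algebra, where $\lambda$ is a formal parameter (i.e. the axioms hold as polynomial identities in $\lambda$). 2-cocycles with adjoint coefficients. $(\psi,\omega,\mu,\nu)$ is a 2-cocycle of $(M,A,f)$ with coefficients in the adjoint representation (that is, $(M,A,f)$ acting on itself by its own operations) if for all $x,y,z\in A$, $a,b\in M$: (1) $\psi(x\cdot a)+f(\mu(x,a))-x\cdot\psi(a)-\omega(x,f(a))=0$; (2) $\psi(a\cdot x)+f(\nu(a,x))-\omega(f(a),x)-\psi(a)\cdot x=0$; (3) $\psi(a)\cdot b+\mu(f(a),b)-a\cdot\psi(b)-\nu(a,f(b))=0$; (4) $x\cdot\omega(y,z)+\omega(x,y\cdot z)-\omega(x\cdot y,z)-\omega(x,y)\cdot z=0$; (5) $x\cdot\mu(y,a)+\mu(x,y\cdot a)-\omega(x,y)\cdot a-\mu(x\cdot y,a)=0$; (6) $a\cdot\omega(x,y)+\nu(a,x\cdot y)-\nu(a,x)\cdot y-\nu(a\cdot x,y)=0$; (7) $x\cdot\nu(a,y)+\mu(x,a\cdot y)-\nu(x\cdot a,y)-\mu(x,a)\cdot y=0$. *)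

theory Defs
  imports Complex_Main "HOL-Computational_Algebra.Polynomial"
begin

text \<open>
  The structures are set up over a commutative ring of scalars, because they are used both over the
  ground field and over the polynomial ring in the deformation parameter. Over a field,
  \<^locale>\<open>module\<close> and \<^locale>\<open>vector_space\<close> have the same axioms. A linear map out of a tensor product
  is represented by the corresponding bilinear map.
\<close>

definition bilinear_map ::
  "('r::comm_ring_1 \<Rightarrow> 'a::ab_group_add \<Rightarrow> 'a) \<Rightarrow> ('r \<Rightarrow> 'b::ab_group_add \<Rightarrow> 'b) \<Rightarrow>
   ('r \<Rightarrow> 'c::ab_group_add \<Rightarrow> 'c) \<Rightarrow> ('a \<Rightarrow> 'b \<Rightarrow> 'c) \<Rightarrow> bool" where
  "bilinear_map s1 s2 s3 B \<longleftrightarrow>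
     (\<forall>x. module_hom s2 s3 (\<lambda>y. B x y)) \<and> (\<forall>y. module_hom s1 s3 (\<lambda>x. B x y))"

locale assoc_algebra = module sA
  for sA :: "'r::comm_ring_1 \<Rightarrow> 'a::ab_group_add \<Rightarrow> 'a" +
  fixes amult :: "'a \<Rightarrow> 'a \<Rightarrow> 'a"
  assumes mult_bilinear: "bilinear_map sA sA sA amult"
    and mult_assoc: "amult (amult x y) z = amult x (amult y z)"

locale algebra_rep = assoc_algebra sA amult + M: module sM
  for sA :: "'r::comm_ring_1 \<Rightarrow> 'a::ab_group_add \<Rightarrow> 'a"
    and sM :: "'r \<Rightarrow> 'm::ab_group_add \<Rightarrow> 'm"
    and amult :: "'a \<Rightarrow> 'a \<Rightarrow> 'a" +
  fixes lact :: "'a \<Rightarrow> 'm \<Rightarrow> 'm"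
    and ract :: "'m \<Rightarrow> 'a \<Rightarrow> 'm"
  assumes lact_bilinear: "bilinear_map sA sM sM lact"
    and ract_bilinear: "bilinear_map sM sA sM ract"
    and lact_mult: "lact (amult x y) m = lact x (lact y m)"
    and lact_ract: "lact x (ract m y) = ract (lact x m) y"
    and ract_mult: "ract m (amult x y) = ract (ract m x) y"

locale crossed_module = algebra_rep sA sM amult lact ract
  for sA :: "'r::comm_ring_1 \<Rightarrow> 'a::ab_group_add \<Rightarrow> 'a"
    and sM :: "'r \<Rightarrow> 'm::ab_group_add \<Rightarrow> 'm"
    and amult :: "'a \<Rightarrow> 'a \<Rightarrow> 'a"
    and lact :: "'a \<Rightarrow> 'm \<Rightarrow> 'm"
    and ract :: "'m \<Rightarrow> 'a \<Rightarrow> 'm" +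
  fixes f :: "'m \<Rightarrow> 'a"
  assumes f_linear: "module_hom sM sA f"
    and f_lact: "f (lact x a) = amult x (f a)"
    and f_ract: "f (ract a x) = amult (f a) x"
    and peiffer: "lact (f a) b = ract a (f b)"

text \<open>
  The formal parameter \<open>\<lambda>\<close> is the polynomial indeterminate: for a \<open>k\<close>-vector space \<open>V\<close> with
  underlying type \<open>'v\<close>, the \<open>k[\<lambda>]\<close>-module \<open>V[\<lambda>]\<close> has underlying type \<open>'v poly\<close>, and
  multiplication by \<open>\<lambda>\<close> is \<^term>\<open>pCons 0\<close>. \<open>poly_ext B\<close> is the \<open>k[\<lambda>]\<close>-bilinear extension of a
  bilinear map \<open>B\<close>; applied to the scalar multiplication of \<open>V\<close> it is the scalar multiplication
  of \<open>V[\<lambda>]\<close>. For linear maps the extension is \<^const>\<open>map_poly\<close>.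
\<close>

definition poly_ext ::
  "('a::zero \<Rightarrow> 'b::zero \<Rightarrow> 'c::comm_monoid_add) \<Rightarrow> 'a poly \<Rightarrow> 'b poly \<Rightarrow> 'c poly" where
  "poly_ext B p q =
     (\<Sum>i\<le>degree p. \<Sum>j\<le>degree q. monom (B (coeff p i) (coeff q j)) (i + j))"

definition deform2 ::
  "('a::zero \<Rightarrow> 'b::zero \<Rightarrow> 'c::comm_monoid_add) \<Rightarrow> ('a \<Rightarrow> 'b \<Rightarrow> 'c) \<Rightarrow>
   'a poly \<Rightarrow> 'b poly \<Rightarrow> 'c poly" where
  "deform2 B C p q = poly_ext B p q + pCons 0 (poly_ext C p q)"

definition deform1 ::
  "('a::zero \<Rightarrow> 'b::comm_monoid_add) \<Rightarrow> ('a \<Rightarrow> 'b) \<Rightarrow> 'a poly \<Rightarrow> 'b poly" where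
  "deform1 g h p = map_poly g p + pCons 0 (map_poly h p)"

lemma deform2_const: "deform2 B C [:x:] [:y:] = [:B x y, C x y:]"
  by (simp add: deform2_def poly_ext_def monom_0)

lemma deform1_const:
  assumes "g 0 = 0" "h 0 = 0"
  shows "deform1 g h [:x:] = [:g x, h x:]"
  using assms by (simp add: deform1_def map_poly_pCons)

text \<open>
  All maps involved being \<open>k[\<lambda>]\<close>-(bi)linear, the crossed module axioms over \<open>k[\<lambda>]\<close> amount to the
  polynomial identities in \<open>\<lambda>\<close> for constant arguments \<open>x, y, z \<in> A\<close> and \<open>a, b \<in> M\<close>.
\<close>

definition generates_infinitesimal_deformation ::
  "('k::field \<Rightarrow> 'a::ab_group_add \<Rightarrow> 'a) \<Rightarrow> ('k \<Rightarrow> 'm::ab_group_add \<Rightarrow> 'm) \<Rightarrow>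
   ('a \<Rightarrow> 'a \<Rightarrow> 'a) \<Rightarrow> ('a \<Rightarrow> 'm \<Rightarrow> 'm) \<Rightarrow> ('m \<Rightarrow> 'a \<Rightarrow> 'm) \<Rightarrow> ('m \<Rightarrow> 'a) \<Rightarrow>
   ('m \<Rightarrow> 'a) \<Rightarrow> ('a \<Rightarrow> 'a \<Rightarrow> 'a) \<Rightarrow> ('a \<Rightarrow> 'm \<Rightarrow> 'm) \<Rightarrow> ('m \<Rightarrow> 'a \<Rightarrow> 'm) \<Rightarrow> bool" where
  "generates_infinitesimal_deformation sA sM amult lact ract f \<psi> \<omega> \<mu> \<nu> \<longleftrightarrow>
     crossed_module (poly_ext sA) (poly_ext sM)
       (deform2 amult \<omega>) (deform2 lact \<mu>) (deform2 ract \<nu>) (deform1 f \<psi>)"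

definition two_cocycle_adjoint ::
  "('a::ab_group_add \<Rightarrow> 'a \<Rightarrow> 'a) \<Rightarrow> ('a \<Rightarrow> 'm::ab_group_add \<Rightarrow> 'm) \<Rightarrow> ('m \<Rightarrow> 'a \<Rightarrow> 'm) \<Rightarrow>
   ('m \<Rightarrow> 'a) \<Rightarrow>
   ('m \<Rightarrow> 'a) \<Rightarrow> ('a \<Rightarrow> 'a \<Rightarrow> 'a) \<Rightarrow> ('a \<Rightarrow> 'm \<Rightarrow> 'm) \<Rightarrow> ('m \<Rightarrow> 'a \<Rightarrow> 'm) \<Rightarrow> bool" where
  "two_cocycle_adjoint amult lact ract f \<psi> \<omega> \<mu> \<nu> \<longleftrightarrow>
     (\<forall>x a. \<psi> (lact x a) + f (\<mu> x a) - amult x (\<psi> a) - \<omega> x (f a) = 0) \<and>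
     (\<forall>a x. \<psi> (ract a x) + f (\<nu> a x) - \<omega> (f a) x - amult (\<psi> a) x = 0) \<and>
     (\<forall>a b. lact (\<psi> a) b + \<mu> (f a) b - ract a (\<psi> b) - \<nu> a (f b) = 0) \<and>
     (\<forall>x y z. amult x (\<omega> y z) + \<omega> x (amult y z) - \<omega> (amult x y) z - amult (\<omega> x y) z = 0) \<and>
     (\<forall>x y a. lact x (\<mu> y a) + \<mu> x (lact y a) - lact (\<omega> x y) a - \<mu> (amult x y) a = 0) \<and>
     (\<forall>a x y. ract a (\<omega> x y) + \<nu> a (amult x y) - ract (\<nu> a x) y - \<nu> (ract a x) y = 0) \<and>
     (\<forall>x a y. lact x (\<nu> a y) + \<mu> x (ract a y) - \<nu> (lact x a) y - ract (\<mu> x a) y = 0)"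

end

theory Submission
  imports Defs
begin

text \<open>
  All maps in question over \<open>k[\<lambda>]\<close> are additive and commute with multiplication by \<open>\<lambda>\<close> in every
  argument, and a map with this property is determined by its values on constant polynomials
  (\<open>shift_linear_eqI\<close>, \<open>shift_trilinear_eqI\<close>). This shows that \<open>V[\<lambda>]\<close> is a module over \<open>k[\<lambda>]\<close>
  and that the deformed maps are (bi)linear, so that these parts of the definition of a crossed module
  hold for all (bi)linear \<open>\<psi>, \<omega>, \<mu>, \<nu>\<close>; and it reduces each remaining axiom to constant arguments.

  On constant arguments, an axiom is an equality of two polynomials of degree at most two in \<open>\<lambda>\<close>.
  Comparing coefficients (\<open>deform2_assoc_iff\<close>, \<open>deform1_left_iff\<close>, \<open>deform1_right_iff\<close>,
  \<open>deform_peiffer_iff\<close>) splits it into three equations: the constant term is the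
  axiom for \<open>(M, A, f)\<close>, the coefficient of \<open>\<lambda>\<close> is one of the cocycle equations, and the coefficient
  of \<open>\<lambda>\<^sup>2\<close> is the axiom for \<open>(M, A, \<psi>)\<close> with operations \<open>\<omega>, \<mu>, \<nu>\<close>.
\<close>

section \<open>Maps commuting with multiplication by the parameter\<close>

text \<open>
  Additive maps of polynomials that commute with multiplication by the indeterminate. Scalars play
  no part here: these are the \<open>\<int>[\<lambda>]\<close>-linear maps.
\<close>

definition shift_linear :: "('a::ab_group_add poly \<Rightarrow> 'b::ab_group_add poly) \<Rightarrow> bool" where
  "shift_linear F \<longleftrightarrow> (\<forall>p q. F (p + q) = F p + F q) \<and> (\<forall>p. F (pCons 0 p) = pCons 0 (F p))"

text \<open>Shift linearity in each argument, i.e. \<open>\<int>[\<lambda>]\<close>-bilinearity.\<close>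

definition shift_bilinear ::
  "('a::ab_group_add poly \<Rightarrow> 'b::ab_group_add poly \<Rightarrow> 'c::ab_group_add poly) \<Rightarrow> bool" where
  "shift_bilinear F \<longleftrightarrow> (\<forall>q. shift_linear (\<lambda>p. F p q)) \<and> (\<forall>p. shift_linear (F p))"

lemma shift_linear_id: "shift_linear (\<lambda>p. p)"
  by (simp add: shift_linear_def)

lemma shift_linear_comp: "shift_linear F \<Longrightarrow> shift_linear G \<Longrightarrow> shift_linear (\<lambda>p. F (G p))"
  by (simp add: shift_linear_def)

lemma shift_bilinear_left:
  "shift_bilinear F \<Longrightarrow> shift_linear G \<Longrightarrow> shift_linear (\<lambda>p. F (G p) q)"
  by (simp add: shift_bilinear_def shift_linear_def)

lemma shift_bilinear_right:
  "shift_bilinear F \<Longrightarrow> shift_linear G \<Longrightarrow> shift_linear (\<lambda>q. F p (G q))"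
  by (simp add: shift_bilinear_def shift_linear_def)

lemma poly_pair: "[:u, v:] = [:u:] + pCons 0 [:v:]" for u v :: "'a::ab_group_add"
  by simp

text \<open>
  The module \<open>V[\<lambda>]\<close> is generated over \<open>\<int>[\<lambda>]\<close> by the constant polynomials, so a shift linear map is
  determined on them.
\<close>

lemma shift_linear_eqI:
  assumes F: "shift_linear F" and G: "shift_linear G"
    and const: "\<And>x. F [:x:] = G [:x:]"
  shows "F p = G p"
proof (induction p)
  case 0
  show ?case using const[of 0] by simp
next
  case (pCons a p)
  have "pCons a p = [:a:] + pCons 0 p" by simp
  then show ?case
    using F G const pCons.IH unfolding shift_linear_def by metis
qed

lemma shift_bilinear_eqI:
  assumes "\<And>q. shift_linear (\<lambda>p. F p q)" "\<And>p. shift_linear (\<lambda>q. F p q)"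
    and "\<And>q. shift_linear (\<lambda>p. G p q)" "\<And>p. shift_linear (\<lambda>q. G p q)"
    and const: "\<And>x y. F [:x:] [:y:] = G [:x:] [:y:]"
  shows "F p q = G p q"
proof (rule shift_linear_eqI[of "\<lambda>p. F p q" "\<lambda>p. G p q"])
  show "F [:x:] q = G [:x:] q" for x
    by (rule shift_linear_eqI[of "F [:x:]" "G [:x:]"]) (use assms in auto)
qed (use assms in auto)

lemma shift_trilinear_eqI:
  assumes "\<And>q r. shift_linear (\<lambda>p. F p q r)" "\<And>p r. shift_linear (\<lambda>q. F p q r)"
    "\<And>p q. shift_linear (\<lambda>r. F p q r)"
    and "\<And>q r. shift_linear (\<lambda>p. G p q r)" "\<And>p r. shift_linear (\<lambda>q. G p q r)"
    "\<And>p q. shift_linear (\<lambda>r. G p q r)"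
    and const: "\<And>x y z. F [:x:] [:y:] [:z:] = G [:x:] [:y:] [:z:]"
  shows "F p q r = G p q r"
proof (rule shift_linear_eqI[of "\<lambda>p. F p q r" "\<lambda>p. G p q r"])
  show "F [:x:] q r = G [:x:] q r" for x
    by (rule shift_bilinear_eqI[of "F [:x:]" "G [:x:]"]) (use assms in auto)
qed (use assms in auto)

section \<open>Extension of biadditive maps to polynomials\<close>

text \<open>
  Additivity in each argument, without scalars: this is what makes \<^const>\<open>poly_ext\<close> shift bilinear.
  It covers the given bilinear maps and the scalar multiplications alike.
\<close>

definition biadditive ::
  "('a::ab_group_add \<Rightarrow> 'b::ab_group_add \<Rightarrow> 'c::ab_group_add) \<Rightarrow> bool" where
  "biadditive B \<longleftrightarrow> (\<forall>x x' y. B (x + x') y = B x y + B x' y) \<and>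
     (\<forall>x y y'. B x (y + y') = B x y + B x y')"

lemma biadditiveD:
  assumes "biadditive B"
  shows "B (x + x') y = B x y + B x' y" "B x (y + y') = B x y + B x y'" "B 0 y = 0" "B x 0 = 0"
proof -
  show add: "B (x + x') y = B x y + B x' y" "B x (y + y') = B x y + B x y'" for x x' y y'
    using assms by (auto simp: biadditive_def)
  show "B 0 y = 0" using add(1)[of 0 0 y] by simp
  show "B x 0 = 0" using add(2)[of x 0 0] by simp
qed

text \<open>The coefficients are given by the convolution formula, as for the product of polynomials.\<close>

lemma coeff_poly_ext:
  assumes "\<And>y. B 0 y = 0" "\<And>x. B x 0 = 0"
  shows "coeff (poly_ext B p q) n = (\<Sum>i\<le>n. B (coeff p i) (coeff q (n - i)))"
proof -
  let ?t = "\<lambda>i. if i \<le> n then B (coeff p i) (coeff q (n - i)) else 0"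
  have inner: "(\<Sum>j\<le>degree q. coeff (monom (B (coeff p i) (coeff q j)) (i + j)) n) = ?t i" for i
  proof (cases "i \<le> n \<and> n - i \<le> degree q")
    case True
    have "(\<Sum>j\<le>degree q. coeff (monom (B (coeff p i) (coeff q j)) (i + j)) n) =
        (\<Sum>j\<le>degree q. if j = n - i then B (coeff p i) (coeff q j) else 0)"
      using True by (intro sum.cong) auto
    also have "\<dots> = ?t i" using True by simp
    finally show ?thesis .
  next
    case False
    then have "i + j \<noteq> n" if "j \<le> degree q" for j using that by auto
    moreover have "?t i = 0" using False by (auto simp: assms coeff_eq_0)
    ultimately show ?thesis by simp
  qed
  have "coeff (poly_ext B p q) n = (\<Sum>i\<le>degree p. ?t i)"
    by (simp add: poly_ext_def coeff_sum inner del: coeff_monom)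
  also have "\<dots> = (\<Sum>i\<in>{..degree p} \<union> {..n}. ?t i)"
    by (rule sum.mono_neutral_left) (auto simp: assms coeff_eq_0)
  also have "\<dots> = (\<Sum>i\<le>n. ?t i)"
    by (rule sum.mono_neutral_right) auto
  finally show ?thesis by simp
qed

lemma poly_ext_const: "poly_ext B [:x:] [:y:] = [:B x y:]"
  by (simp add: poly_ext_def monom_0)

lemma shift_bilinear_poly_ext:
  assumes B: "biadditive B"
  shows "shift_bilinear (poly_ext B)"
proof -
  note coeff = coeff_poly_ext[of B, OF biadditiveD(3,4)[OF B]]
  have "poly_ext B (p + p') q = poly_ext B p q + poly_ext B p' q" for p p' q
    by (rule poly_eqI) (simp add: coeff biadditiveD[OF B] sum.distrib)
  moreover have "poly_ext B p (q + q') = poly_ext B p q + poly_ext B p q'" for p q q'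
    by (rule poly_eqI) (simp add: coeff biadditiveD[OF B] sum.distrib)
  moreover have "poly_ext B (pCons 0 p) q = pCons 0 (poly_ext B p q)" for p q
  proof (rule poly_eqI)
    show "coeff (poly_ext B (pCons 0 p) q) n = coeff (pCons 0 (poly_ext B p q)) n" for n
      by (cases n) (simp_all add: coeff biadditiveD[OF B] sum.atMost_Suc_shift del: sum.atMost_Suc)
  qed
  moreover have "poly_ext B p (pCons 0 q) = pCons 0 (poly_ext B p q)" for p q
  proof (rule poly_eqI)
    show "coeff (poly_ext B p (pCons 0 q)) n = coeff (pCons 0 (poly_ext B p q)) n" for n
      by (cases n) (simp_all add: coeff biadditiveD[OF B] Suc_diff_le)
  qed
  ultimately show ?thesis
    by (simp add: shift_bilinear_def shift_linear_def)
qed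

lemma shift_bilinear_deform2:
  assumes "biadditive B" "biadditive C"
  shows "shift_bilinear (deform2 B C)"
  using shift_bilinear_poly_ext[OF assms(1)] shift_bilinear_poly_ext[OF assms(2)]
  by (simp add: shift_bilinear_def shift_linear_def deform2_def)

lemma shift_linear_map_poly:
  assumes "additive g"
  shows "shift_linear (map_poly g)"
proof -
  have "g 0 = 0" using assms by (rule additive.zero)
  then show ?thesis
    by (auto simp: shift_linear_def poly_eq_iff coeff_map_poly additive.add[OF assms]
        map_poly_pCons)
qed

lemma shift_linear_deform1:
  assumes "additive g" "additive h"
  shows "shift_linear (deform1 g h)"
  using shift_linear_map_poly[OF assms(1)] shift_linear_map_poly[OF assms(2)]
  by (simp add: shift_linear_def deform1_def)

section \<open>Modules and bilinear maps over the polynomial ring\<close>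

lemma module_hom_additive: "module_hom s1 s2 g \<Longrightarrow> additive g"
  by (simp add: additive_def module_hom.add)

lemma bilinear_map_biadditive: "bilinear_map s1 s2 s3 B \<Longrightarrow> biadditive B"
  by (simp add: bilinear_map_def biadditive_def module_hom_iff)

lemma bilinear_map_scale:
  assumes "bilinear_map s1 s2 s3 B"
  shows "B (s1 c x) y = s3 c (B x y)" "B x (s2 c y) = s3 c (B x y)"
  using assms by (simp_all add: bilinear_map_def module_hom_iff)

lemma bilinear_map_modules:
  assumes "bilinear_map s1 s2 s3 B"
  shows "module s1" "module s2" "module s3"
  using assms by (simp_all add: bilinear_map_def module_hom_iff)

lemma module_biadditive: "module s \<Longrightarrow> biadditive s"
  by (simp add: biadditive_def module.scale_left_distrib module.scale_right_distrib)

lemma shift_bilinear_times: "shift_bilinear ((*) :: 'a::comm_ring_1 poly \<Rightarrow> _)"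
  by (simp add: shift_bilinear_def shift_linear_def algebra_simps)

lemma module_poly_ext:
  assumes s: "module s"
  shows "module (poly_ext s)"
proof -
  have sb: "shift_bilinear (poly_ext s)"
    by (intro shift_bilinear_poly_ext module_biadditive s)
  have "poly_ext s a (poly_ext s b p) = poly_ext s (a * b) p" for a b p
    by (rule shift_trilinear_eqI[of "\<lambda>a b p. poly_ext s a (poly_ext s b p)"
          "\<lambda>a b p. poly_ext s (a * b) p"])
      (intro shift_linear_id shift_bilinear_left[OF sb] shift_bilinear_right[OF sb]
          shift_bilinear_left[OF shift_bilinear_times] shift_bilinear_right[OF shift_bilinear_times]
        | simp add: poly_ext_const module.scale_scale[OF s] mult.commute)+
  moreover have "poly_ext s 1 p = p" for p
    by (rule shift_linear_eqI[of "poly_ext s 1" "\<lambda>p. p"])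
      (use sb in \<open>simp_all add: shift_linear_id shift_bilinear_def poly_ext_const one_pCons
         module.scale_one[OF s]\<close>)
  ultimately show ?thesis
    using sb unfolding module_def shift_bilinear_def shift_linear_def by blast
qed

lemma poly_ext_scale:
  assumes B: "bilinear_map s1 s2 s3 B"
  shows "poly_ext B (poly_ext s1 c p) q = poly_ext s3 c (poly_ext B p q)"
    and "poly_ext B p (poly_ext s2 c q) = poly_ext s3 c (poly_ext B p q)"
proof -
  note sb = shift_bilinear_poly_ext[OF bilinear_map_biadditive[OF B]]
    bilinear_map_modules[OF B, THEN module_biadditive, THEN shift_bilinear_poly_ext]
  note sl = shift_linear_id sb[THEN shift_bilinear_left] sb[THEN shift_bilinear_right]
  show "poly_ext B (poly_ext s1 c p) q = poly_ext s3 c (poly_ext B p q)"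
    by (rule shift_trilinear_eqI[of "\<lambda>c p q. poly_ext B (poly_ext s1 c p) q"
          "\<lambda>c p q. poly_ext s3 c (poly_ext B p q)"])
      (intro sl | simp add: poly_ext_const bilinear_map_scale[OF B])+
  show "poly_ext B p (poly_ext s2 c q) = poly_ext s3 c (poly_ext B p q)"
    by (rule shift_trilinear_eqI[of "\<lambda>c p q. poly_ext B p (poly_ext s2 c q)"
          "\<lambda>c p q. poly_ext s3 c (poly_ext B p q)"])
      (intro sl | simp add: poly_ext_const bilinear_map_scale[OF B])+
qed

lemma bilinear_map_deform2:
  assumes B: "bilinear_map s1 s2 s3 B" and C: "bilinear_map s1 s2 s3 C"
  shows "bilinear_map (poly_ext s1) (poly_ext s2) (poly_ext s3) (deform2 B C)"
proof -
  note m = bilinear_map_modules[OF B]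
  have "shift_bilinear (poly_ext s3)"
    by (intro shift_bilinear_poly_ext module_biadditive m)
  then have "poly_ext s3 c (p + pCons 0 q) = poly_ext s3 c p + pCons 0 (poly_ext s3 c q)" for c p q
    by (simp add: shift_bilinear_def shift_linear_def)
  then have "deform2 B C (poly_ext s1 c p) q = poly_ext s3 c (deform2 B C p q)"
    "deform2 B C p (poly_ext s2 c q) = poly_ext s3 c (deform2 B C p q)" for c p q
    by (simp_all add: deform2_def poly_ext_scale[OF B] poly_ext_scale[OF C])
  moreover have "shift_bilinear (deform2 B C)"
    by (intro shift_bilinear_deform2 bilinear_map_biadditive[OF B] bilinear_map_biadditive[OF C])
  ultimately show ?thesis
    using m by (simp add: bilinear_map_def module_hom_iff module_poly_ext shift_bilinear_def
        shift_linear_def)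
qed

lemma module_hom_deform1:
  assumes g: "module_hom s1 s2 g" and h: "module_hom s1 s2 h"
  shows "module_hom (poly_ext s1) (poly_ext s2) (deform1 g h)"
proof -
  have m: "module s1" "module s2" using g by (simp_all add: module_hom_iff)
  have sb: "shift_bilinear (poly_ext s1)" "shift_bilinear (poly_ext s2)"
    by (intro shift_bilinear_poly_ext module_biadditive m)+
  have sl: "shift_linear (deform1 g h)"
    by (intro shift_linear_deform1 module_hom_additive[OF g] module_hom_additive[OF h])
  have zero: "g 0 = 0" "h 0 = 0" using g h by (simp_all add: module_hom.zero)
  have scale_pair: "poly_ext s2 [:c:] [:u, v:] = [:s2 c u, s2 c v:]" for c u v
  proof -
    have "poly_ext s2 [:c:] [:u, v:] = poly_ext s2 [:c:] [:u:] + pCons 0 (poly_ext s2 [:c:] [:v:])"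
      using sb(2) unfolding shift_bilinear_def shift_linear_def by (metis poly_pair)
    then show ?thesis by (simp add: poly_ext_const)
  qed
  have "deform1 g h (poly_ext s1 c p) = poly_ext s2 c (deform1 g h p)" for c p
    by (rule shift_bilinear_eqI[of "\<lambda>c p. deform1 g h (poly_ext s1 c p)"
          "\<lambda>c p. poly_ext s2 c (deform1 g h p)"])
      (intro shift_linear_id sb[THEN shift_bilinear_left] sb[THEN shift_bilinear_right]
          shift_linear_comp[OF sl]
        | simp add: poly_ext_const deform1_const zero scale_pair
            module_hom.scale[OF g] module_hom.scale[OF h])+
  then show ?thesis
    using m sl by (simp add: module_hom_iff module_poly_ext shift_linear_def)
qed

section \<open>Comparison of coefficients\<close>

lemma deform2_const_pair:
  assumes "biadditive B" "biadditive C"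
  shows "deform2 B C [:x:] [:u, v:] = [:B x u, C x u + B x v, C x v:]"
    and "deform2 B C [:u', v':] [:y:] = [:B u' y, C u' y + B v' y, C v' y:]"
proof -
  note sl = shift_bilinear_deform2[OF assms, unfolded shift_bilinear_def shift_linear_def]
  have "deform2 B C [:x:] [:u, v:] = deform2 B C [:x:] [:u:] + pCons 0 (deform2 B C [:x:] [:v:])"
    using sl by (metis poly_pair)
  then show "deform2 B C [:x:] [:u, v:] = [:B x u, C x u + B x v, C x v:]"
    by (simp add: deform2_const)
  have "deform2 B C [:u', v':] [:y:] = deform2 B C [:u':] [:y:] + pCons 0 (deform2 B C [:v':] [:y:])"
    using sl by (metis poly_pair)
  then show "deform2 B C [:u', v':] [:y:] = [:B u' y, C u' y + B v' y, C v' y:]"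
    by (simp add: deform2_const)
qed

lemma deform1_pair:
  assumes "additive g" "additive h"
  shows "deform1 g h [:u, v:] = [:g u, h u + g v, h v:]"
  by (simp add: deform1_def map_poly_pCons additive.zero[OF assms(1)] additive.zero[OF assms(2)])

lemma poly_eq_triple_iff:
  "[:a, b, c:] = [:a', b', c':] \<longleftrightarrow> a = a' \<and> b = b' \<and> c = c'"
  by simp

text \<open>
  The common shape of associativity and of the three axioms of a representation. The equation for
  the coefficient of \<open>\<lambda>\<close> is written with the sides exchanged, as in the cocycle equations.
\<close>

lemma deform2_assoc_iff:
  assumes ba: "biadditive B1" "biadditive C1" "biadditive B2" "biadditive C2"
    "biadditive B3" "biadditive C3" "biadditive B4" "biadditive C4"
  shows "(\<forall>p q r. deform2 B1 C1 (deform2 B2 C2 p q) r = deform2 B3 C3 p (deform2 B4 C4 q r)) \<longleftrightarrow>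
    (\<forall>x y z. B1 (B2 x y) z = B3 x (B4 y z) \<and>
       C3 x (B4 y z) + B3 x (C4 y z) = C1 (B2 x y) z + B1 (C2 x y) z \<and>
       C1 (C2 x y) z = C3 x (C4 y z))" (is "?L \<longleftrightarrow> ?R")
proof -
  note sb = shift_bilinear_deform2[OF ba(1,2)] shift_bilinear_deform2[OF ba(3,4)]
    shift_bilinear_deform2[OF ba(5,6)] shift_bilinear_deform2[OF ba(7,8)]
  have "?L \<longleftrightarrow> (\<forall>x y z. deform2 B1 C1 (deform2 B2 C2 [:x:] [:y:]) [:z:] =
      deform2 B3 C3 [:x:] (deform2 B4 C4 [:y:] [:z:]))" (is "_ \<longleftrightarrow> ?K")
  proof (intro iffI allI)
    fix p q r
    assume K: ?K
    show "deform2 B1 C1 (deform2 B2 C2 p q) r = deform2 B3 C3 p (deform2 B4 C4 q r)"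
      by (rule shift_trilinear_eqI[of "\<lambda>p q r. deform2 B1 C1 (deform2 B2 C2 p q) r"
            "\<lambda>p q r. deform2 B3 C3 p (deform2 B4 C4 q r)"])
        (intro shift_linear_id sb[THEN shift_bilinear_left] sb[THEN shift_bilinear_right] | simp add: K)+
  qed simp
  then show ?thesis
    by (simp only: deform2_const poly_eq_triple_iff deform2_const_pair[OF ba(1,2)]
        deform2_const_pair[OF ba(3,4)] deform2_const_pair[OF ba(5,6)]
        deform2_const_pair[OF ba(7,8)] eq_commute[of "C1 _ _ + _" "C3 _ _ + _"])
qed

lemma deform1_left_iff:
  assumes ad: "additive g" "additive h"
    and ba: "biadditive B" "biadditive C" "biadditive B'" "biadditive C'"
  shows "(\<forall>p q. deform1 g h (deform2 B C p q) = deform2 B' C' p (deform1 g h q)) \<longleftrightarrow>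
    (\<forall>x y. g (B x y) = B' x (g y) \<and>
       h (B x y) + g (C x y) = C' x (g y) + B' x (h y) \<and> h (C x y) = C' x (h y))"
    (is "?L \<longleftrightarrow> ?R")
proof -
  note sl = shift_linear_deform1[OF ad]
  note sb = shift_bilinear_deform2[OF ba(1,2)] shift_bilinear_deform2[OF ba(3,4)]
  have "?L \<longleftrightarrow> (\<forall>x y. deform1 g h (deform2 B C [:x:] [:y:]) =
      deform2 B' C' [:x:] (deform1 g h [:y:]))" (is "_ \<longleftrightarrow> ?K")
  proof (intro iffI allI)
    fix p q
    assume K: ?K
    show "deform1 g h (deform2 B C p q) = deform2 B' C' p (deform1 g h q)"
      by (rule shift_bilinear_eqI[of "\<lambda>p q. deform1 g h (deform2 B C p q)"
            "\<lambda>p q. deform2 B' C' p (deform1 g h q)"])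
        (intro shift_linear_id sb[THEN shift_bilinear_left] sb[THEN shift_bilinear_right]
          shift_linear_comp[OF sl] | simp add: K)+
  qed simp
  then show ?thesis
    by (simp only: deform2_const deform1_const additive.zero ad poly_eq_triple_iff
        deform1_pair[OF ad] deform2_const_pair[OF ba(1,2)] deform2_const_pair[OF ba(3,4)])
qed

lemma deform1_right_iff:
  assumes ad: "additive g" "additive h"
    and ba: "biadditive B" "biadditive C" "biadditive B'" "biadditive C'"
  shows "(\<forall>q p. deform1 g h (deform2 B C q p) = deform2 B' C' (deform1 g h q) p) \<longleftrightarrow>
    (\<forall>y x. g (B y x) = B' (g y) x \<and>
       h (B y x) + g (C y x) = C' (g y) x + B' (h y) x \<and> h (C y x) = C' (h y) x)"
    (is "?L \<longleftrightarrow> ?R")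
proof -
  note sl = shift_linear_deform1[OF ad]
  note sb = shift_bilinear_deform2[OF ba(1,2)] shift_bilinear_deform2[OF ba(3,4)]
  have "?L \<longleftrightarrow> (\<forall>y x. deform1 g h (deform2 B C [:y:] [:x:]) =
      deform2 B' C' (deform1 g h [:y:]) [:x:])" (is "_ \<longleftrightarrow> ?K")
  proof (intro iffI allI)
    fix q p
    assume K: ?K
    show "deform1 g h (deform2 B C q p) = deform2 B' C' (deform1 g h q) p"
      by (rule shift_bilinear_eqI[of "\<lambda>q p. deform1 g h (deform2 B C q p)"
            "\<lambda>q p. deform2 B' C' (deform1 g h q) p"])
        (intro shift_linear_id sb[THEN shift_bilinear_left] sb[THEN shift_bilinear_right]
          shift_linear_comp[OF sl] | simp add: K)+
  qed simp
  then show ?thesis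
    by (simp only: deform2_const deform1_const additive.zero ad poly_eq_triple_iff
        deform1_pair[OF ad] deform2_const_pair[OF ba(1,2)] deform2_const_pair[OF ba(3,4)])
qed

lemma deform_peiffer_iff:
  assumes ad: "additive g" "additive h"
    and ba: "biadditive B" "biadditive C" "biadditive B'" "biadditive C'"
  shows "(\<forall>p q. deform2 B C (deform1 g h p) q = deform2 B' C' p (deform1 g h q)) \<longleftrightarrow>
    (\<forall>x y. B (g x) y = B' x (g y) \<and>
       C (g x) y + B (h x) y = C' x (g y) + B' x (h y) \<and> C (h x) y = C' x (h y))"
    (is "?L \<longleftrightarrow> ?R")
proof -
  note sl = shift_linear_deform1[OF ad]
  note sb = shift_bilinear_deform2[OF ba(1,2)] shift_bilinear_deform2[OF ba(3,4)]
  have "?L \<longleftrightarrow> (\<forall>x y. deform2 B C (deform1 g h [:x:]) [:y:] =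
      deform2 B' C' [:x:] (deform1 g h [:y:]))" (is "_ \<longleftrightarrow> ?K")
  proof (intro iffI allI)
    fix p q
    assume K: ?K
    show "deform2 B C (deform1 g h p) q = deform2 B' C' p (deform1 g h q)"
      by (rule shift_bilinear_eqI[of "\<lambda>p q. deform2 B C (deform1 g h p) q"
            "\<lambda>p q. deform2 B' C' p (deform1 g h q)"])
        (intro shift_linear_id sb[THEN shift_bilinear_left] sb[THEN shift_bilinear_right]
          shift_linear_comp[OF sl] | simp add: K)+
  qed simp
  then show ?thesis
    by (simp only: deform2_const deform1_const additive.zero ad poly_eq_triple_iff
        deform1_pair[OF ad] deform2_const_pair[OF ba(1,2)] deform2_const_pair[OF ba(3,4)])
qed

section \<open>Deformations of crossed modules\<close>

text \<open>
  The equations in the definition of a crossed module, separated from the (bi)linearity conditions.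
  The representation axioms on mixed and right actions are oriented as in \<open>deform2_assoc_iff\<close>.
\<close>

definition crossed_module_equations ::
  "('a \<Rightarrow> 'a \<Rightarrow> 'a) \<Rightarrow> ('a \<Rightarrow> 'm \<Rightarrow> 'm) \<Rightarrow> ('m \<Rightarrow> 'a \<Rightarrow> 'm) \<Rightarrow> ('m \<Rightarrow> 'a) \<Rightarrow> bool" where
  "crossed_module_equations amult lact ract f \<longleftrightarrow>
     (\<forall>x y z. amult (amult x y) z = amult x (amult y z)) \<and>
     (\<forall>x y a. lact (amult x y) a = lact x (lact y a)) \<and>
     (\<forall>x a y. ract (lact x a) y = lact x (ract a y)) \<and>
     (\<forall>a x y. ract (ract a x) y = ract a (amult x y)) \<and>
     (\<forall>x a. f (lact x a) = amult x (f a)) \<and>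
     (\<forall>a x. f (ract a x) = amult (f a) x) \<and>
     (\<forall>a b. lact (f a) b = ract a (f b))"

lemma crossed_module_iff:
  "crossed_module sA sM amult lact ract f \<longleftrightarrow>
     bilinear_map sA sA sA amult \<and> bilinear_map sA sM sM lact \<and> bilinear_map sM sA sM ract \<and>
     module_hom sM sA f \<and> crossed_module_equations amult lact ract f"
proof -
  have "module sA \<and> module sM" if "module_hom sM sA f"
    using that by (simp add: module_hom_iff)
  then show ?thesis
    unfolding crossed_module_def crossed_module_axioms_def algebra_rep_def algebra_rep_axioms_def
      assoc_algebra_def assoc_algebra_axioms_def crossed_module_equations_def
      eq_commute[of "ract (lact _ _) _"] eq_commute[of "ract (ract _ _) _"]
    by blast
qed

theorem theorem5p5:
  fixes sA :: "'k::field \<Rightarrow> 'a::ab_group_add \<Rightarrow> 'a"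
    and sM :: "'k \<Rightarrow> 'm::ab_group_add \<Rightarrow> 'm"
    and amult :: "'a \<Rightarrow> 'a \<Rightarrow> 'a"
    and lact :: "'a \<Rightarrow> 'm \<Rightarrow> 'm"
    and ract :: "'m \<Rightarrow> 'a \<Rightarrow> 'm"
    and f \<psi> :: "'m \<Rightarrow> 'a"
    and \<omega> :: "'a \<Rightarrow> 'a \<Rightarrow> 'a"
    and \<mu> :: "'a \<Rightarrow> 'm \<Rightarrow> 'm"
    and \<nu> :: "'m \<Rightarrow> 'a \<Rightarrow> 'm"
  assumes "vector_space sA" and "vector_space sM"
    and "crossed_module sA sM amult lact ract f"
    and "Vector_Spaces.linear sM sA \<psi>"
    and "bilinear_map sA sA sA \<omega>"
    and "bilinear_map sA sM sM \<mu>"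
    and "bilinear_map sM sA sM \<nu>"
  shows "generates_infinitesimal_deformation sA sM amult lact ract f \<psi> \<omega> \<mu> \<nu> \<longleftrightarrow>
    two_cocycle_adjoint amult lact ract f \<psi> \<omega> \<mu> \<nu> \<and>
    crossed_module sA sM \<omega> \<mu> \<nu> \<psi>"
proof -
  have bl: "bilinear_map sA sA sA amult" "bilinear_map sA sM sM lact" "bilinear_map sM sA sM ract"
    and f: "module_hom sM sA f" and eqs: "crossed_module_equations amult lact ract f"
    using assms(3) by (simp_all add: crossed_module_iff)
  have \<psi>: "module_hom sM sA \<psi>" using assms(4) by (simp add: Vector_Spaces.linear_def)
  note ba = bl[THEN bilinear_map_biadditive] assms(5-7)[THEN bilinear_map_biadditive]
  note ad = f[THEN module_hom_additive] \<psi>[THEN module_hom_additive]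
  have "generates_infinitesimal_deformation sA sM amult lact ract f \<psi> \<omega> \<mu> \<nu> \<longleftrightarrow>
      crossed_module_equations (deform2 amult \<omega>) (deform2 lact \<mu>) (deform2 ract \<nu>) (deform1 f \<psi>)"
    using bl f \<psi> assms(5-7)
    by (simp add: generates_infinitesimal_deformation_def crossed_module_iff bilinear_map_deform2
        module_hom_deform1)
  also have "\<dots> \<longleftrightarrow>
      two_cocycle_adjoint amult lact ract f \<psi> \<omega> \<mu> \<nu> \<and> crossed_module_equations \<omega> \<mu> \<nu> \<psi>"
  proof -
    have cocycle: "two_cocycle_adjoint amult lact ract f \<psi> \<omega> \<mu> \<nu> \<longleftrightarrow>
       (\<forall>x y z. \<omega> x (amult y z) + amult x (\<omega> y z) = \<omega> (amult x y) z + amult (\<omega> x y) z) \<and>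
       (\<forall>x y a. \<mu> x (lact y a) + lact x (\<mu> y a) = \<mu> (amult x y) a + lact (\<omega> x y) a) \<and>
       (\<forall>x a y. \<mu> x (ract a y) + lact x (\<nu> a y) = \<nu> (lact x a) y + ract (\<mu> x a) y) \<and>
       (\<forall>a x y. \<nu> a (amult x y) + ract a (\<omega> x y) = \<nu> (ract a x) y + ract (\<nu> a x) y) \<and>
       (\<forall>x a. \<psi> (lact x a) + f (\<mu> x a) = \<omega> x (f a) + amult x (\<psi> a)) \<and>
       (\<forall>a x. \<psi> (ract a x) + f (\<nu> a x) = \<omega> (f a) x + amult (\<psi> a) x) \<and>
       (\<forall>a b. \<mu> (f a) b + lact (\<psi> a) b = \<nu> a (f b) + ract a (\<psi> b))"
      unfolding two_cocycle_adjoint_def diff_diff_eq right_minus_eq by (simp only: ac_simps)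
    \<comment> \<open>The constant terms of the deformed equations are the axioms \<open>eqs\<close> of the given crossed module.\<close>
    show ?thesis
      using eqs unfolding cocycle crossed_module_equations_def
        deform2_assoc_iff[OF ba(1,4,1,4,1,4,1,4)]
        deform2_assoc_iff[OF ba(2,5,1,4,2,5,2,5)]
        deform2_assoc_iff[OF ba(3,6,2,5,2,5,3,6)]
        deform2_assoc_iff[OF ba(3,6,3,6,3,6,1,4)]
        deform1_left_iff[OF ad ba(2,5,1,4)]
        deform1_right_iff[OF ad ba(3,6,1,4)]
        deform_peiffer_iff[OF ad ba(2,5,3,6)]
      by (simp only: all_conj_distrib simp_thms conj_ac)
  qed
  also have "\<dots> \<longleftrightarrow> two_cocycle_adjoint amult lact ract f \<psi> \<omega> \<mu> \<nu> \<and> crossed_module sA sM \<omega> \<mu> \<nu> \<psi>"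
    using \<psi> assms(5-7) by (simp add: crossed_module_iff)
  finally show ?thesis .
qed

end
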